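(* Let $(X,d)$ be a compact metric space, let $f_n:X\to X$ be continuous for every $n\ge0$, let $A=(a_{ij})_{N\times N}$ be a transition matrix, and let $\{V_{i,n}\}_{n=0}^\infty$, $1\le i\le N$, be sequences of nonempty closed subsets of $X$ with $V_{i,n}\cap V_{j,n}=\emptyset$ for all $1\le i\ne j\le N$ and $n\ge0$. Assume that $V_\alpha^{m,n}:=\bigcap_{k=0}^{m}f_n^{-k}(V_{a_k,n+k})\ne\emptyset$ for all $m,n\ge0$ and all $\alpha=(a_0,a_1,\dots)\in\Sigma_N^+(A)$. Then for every $n\ge0$ there exists a nonempty compact subset $\mathcal C_n\subset\bigcup_{i=1}^N\langle V_{i,n}\rangle$ of $\mathcal K(X)$ with $\bar f_n(\mathcal C_n)\subset\mathcal C_{n+1}$ such that the invariant subsystem of the induced set-valued system $A_{n+1}=\bar f_n(A_n)$ on $\{\mathcal C_n\}_{n=0}^\infty$ is topologically semiconjugate to $(\Sigma_N^+(A),\sigma_A)$.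
   Context: Notation: $f_i^n:=f_{i+n-1}\circ\cdots\circ f_i$ for $n\ge1$, $f_i^0$ is the identity, and $f_i^{-n}:=(f_i^n)^{-1}$ (preimage). $\mathcal K(X)$ is the set of all nonempty compact subsets of $X$ with the Hausdorff metric $\mathcal H_d(B,C):=\max\{\sup_{b\in B}d(b,C),\sup_{c\in C}d(c,B)\}$. For nonempty $K\subset X$, $\langle K\rangle:=\{B\in\mathcal K(X):B\subset K\}$; $\bar f_n:\mathcal K(X)\to\mathcal K(X)$ is $\bar f_n(B):=f_n(B)$. In $\bar f_n(\mathcal C_n)$ the map $\bar f_n$ is applied elementwise: $\bar f_n(\mathcal C_n)=\{\bar f_n(B):B\in\mathcal C_n\}$. A transition matrix is a matrix $A=(a_{ij})_{N\times N}$, $N\ge2$, with $a_{ij}\in\{0,1\}$, $\sum_{j=1}^N a_{ij}\ge1$ for all $i$ and $\sum_{i=1}^N a_{ij}\ge1$ for all $j$. $\Sigma_N^+(A):=\{s=(s_0,s_1,\dots):1\le s_j\le N,\ a_{s_js_{j+1}}=1,\ j\ge0\}$, with metric $\hat\rho(\alpha,\beta):=\sum_{i=0}^\infty \hat d(a_i,b_i)/2^i$ for $\alpha=(a_0,a_1,\dots)$, $\beta=(b_0,b_1,\dots)$, where $\hat d(a,b)=0$ if $a=b$ and $1$ otherwise. $\sigma_A:\Sigma_N^+(A)\to\Sigma_N^+(A)$, $\sigma_A((s_0,s_1,s_2,\dots)):=(s_1,s_2,\dots)$. For subsets $\mathcal C_n\subset\mathcal K(X)$ with $\bar f_n(\mathcal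 C_n)\subset\mathcal C_{n+1}$ for all $n\ge0$, the set-valued system restricted to $\{\mathcal C_n\}$ is called its invariant subsystem on $\{\mathcal C_n\}_{n=0}^\infty$. It is topologically semiconjugate to $(\Sigma_N^+(A),\sigma_A)$ if for every $n\ge0$ there is a continuous surjective map $h_n:\mathcal C_n\to\Sigma_N^+(A)$ with $h_{n+1}\circ\bar f_n=\sigma_A\circ h_n$ on $\mathcal C_n$. *)

theory Defs
  imports "HOL-Analysis.Analysis"
begin

definition hyperspace :: "'a::metric_space set set" where
  "hyperspace = {B. compact B \<and> B \<noteq> {}}"

definition hyperspace_within :: "'a::metric_space set \<Rightarrow> 'a set set" where
  "hyperspace_within K = {B \<in> hyperspace. B \<subseteq> K}"

text \<open>
  The locale \<^locale>\<open>Metric_space\<close> asks for nonnegativity and symmetry on the whole type,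
  not only on the carrier, hence the irrelevant value 0 outside the hyperspace.
\<close>

definition hausdorff_dist :: "'a::metric_space set \<Rightarrow> 'a set \<Rightarrow> real" where
  "hausdorff_dist B C =
     (if B \<in> hyperspace \<and> C \<in> hyperspace
      then max (SUP b\<in>B. infdist b C) (SUP c\<in>C. infdist c B) else 0)"

definition hyperspace_topology :: "'a::metric_space set topology" where
  "hyperspace_topology = Metric_space.mtopology hyperspace hausdorff_dist"

definition induced_map :: "(nat \<Rightarrow> 'a \<Rightarrow> 'a) \<Rightarrow> nat \<Rightarrow> 'a set \<Rightarrow> 'a set" where
  "induced_map f n B = f n ` B"

primrec f_iter :: "(nat \<Rightarrow> 'a \<Rightarrow> 'a) \<Rightarrow> nat \<Rightarrow> nat \<Rightarrow> 'a \<Rightarrow> 'a" where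
  "f_iter f i 0 = id"
| "f_iter f i (Suc n) = f (i + n) \<circ> f_iter f i n"

definition itinerary_set ::
    "(nat \<Rightarrow> 'a \<Rightarrow> 'a) \<Rightarrow> (nat \<Rightarrow> nat \<Rightarrow> 'a set) \<Rightarrow> (nat \<Rightarrow> nat) \<Rightarrow> nat \<Rightarrow> nat \<Rightarrow> 'a set" where
  "itinerary_set f V \<alpha> m n = (\<Inter>k\<in>{0..m}. f_iter f n k -` V (\<alpha> k) (n + k))"

text \<open>Only the entries \<open>A i j\<close> with \<open>i\<close> and \<open>j\<close> in \<open>{1..N}\<close> are meaningful.\<close>

definition transition_matrix :: "nat \<Rightarrow> (nat \<Rightarrow> nat \<Rightarrow> nat) \<Rightarrow> bool" where
  "transition_matrix N A \<longleftrightarrow>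
     2 \<le> N \<and>
     (\<forall>i\<in>{1..N}. \<forall>j\<in>{1..N}. A i j \<in> {0, 1}) \<and>
     (\<forall>i\<in>{1..N}. (\<Sum>j=1..N. A i j) \<ge> 1) \<and>
     (\<forall>j\<in>{1..N}. (\<Sum>i=1..N. A i j) \<ge> 1)"

definition shift_space :: "nat \<Rightarrow> (nat \<Rightarrow> nat \<Rightarrow> nat) \<Rightarrow> (nat \<Rightarrow> nat) set" where
  "shift_space N A = {s. \<forall>j. s j \<in> {1..N} \<and> A (s j) (s (Suc j)) = 1}"

definition shift_dist :: "(nat \<Rightarrow> nat) \<Rightarrow> (nat \<Rightarrow> nat) \<Rightarrow> real" where
  "shift_dist \<alpha> \<beta> = (\<Sum>i. (if \<alpha> i = \<beta> i then 0 else 1) / 2 ^ i)"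

definition shift_topology :: "nat \<Rightarrow> (nat \<Rightarrow> nat \<Rightarrow> nat) \<Rightarrow> (nat \<Rightarrow> nat) topology" where
  "shift_topology N A = Metric_space.mtopology (shift_space N A) shift_dist"

definition shift :: "(nat \<Rightarrow> nat) \<Rightarrow> nat \<Rightarrow> nat" where
  "shift s = (\<lambda>j. s (Suc j))"

text \<open>
  The nonautonomous system has phase space \<open>T n\<close> at time \<open>n\<close>, and \<open>g n\<close> maps the
  phase space at time \<open>n\<close> to that at time \<open>n + 1\<close>.
\<close>

definition topologically_semiconjugate ::
    "(nat \<Rightarrow> 'x topology) \<Rightarrow> (nat \<Rightarrow> 'x \<Rightarrow> 'x) \<Rightarrow> 'y topology \<Rightarrow> ('y \<Rightarrow> 'y) \<Rightarrow> bool" where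
  "topologically_semiconjugate T g Y s \<longleftrightarrow>
     (\<exists>h. \<forall>n. continuous_map (T n) Y (h n) \<and>
              h n ` topspace (T n) = topspace Y \<and>
              (\<forall>x\<in>topspace (T n). h (Suc n) (g n x) = s (h n x)))"

lemma hausdorff_dist_commute: "hausdorff_dist B C = hausdorff_dist C B"
  by (auto simp: hausdorff_dist_def max.commute)

lemma bdd_above_infdist_image:
  fixes B C :: "'a::metric_space set"
  assumes "compact B"
  shows "bdd_above ((\<lambda>b. infdist b C) ` B)"
proof -
  have "compact ((\<lambda>b. infdist b C) ` B)"
    by (intro compact_continuous_image continuous_intros assms)
  then show ?thesis
    by (simp add: bounded_imp_bdd_above compact_imp_bounded)
qed

lemma infdist_le_hausdorff_dist:
  assumes "B \<in> hyperspace" "C \<in> hyperspace" "b \<in> B"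
  shows "infdist b C \<le> hausdorff_dist B C"
proof -
  have "infdist b C \<le> (SUP b\<in>B. infdist b C)"
    using assms by (intro cSUP_upper bdd_above_infdist_image) (auto simp: hyperspace_def)
  then show ?thesis
    using assms by (simp add: hausdorff_dist_def)
qed

lemma hausdorff_dist_le:
  assumes "B \<in> hyperspace" "C \<in> hyperspace"
    and "\<And>b. b \<in> B \<Longrightarrow> infdist b C \<le> r" "\<And>c. c \<in> C \<Longrightarrow> infdist c B \<le> r"
  shows "hausdorff_dist B C \<le> r"
proof -
  have "(SUP b\<in>B. infdist b C) \<le> r" "(SUP c\<in>C. infdist c B) \<le> r"
    using assms by (auto intro!: cSUP_least simp: hyperspace_def)
  then show ?thesis
    using assms by (simp add: hausdorff_dist_def)
qed

lemma hausdorff_dist_nonneg: "0 \<le> hausdorff_dist B C"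
proof (cases "B \<in> hyperspace \<and> C \<in> hyperspace")
  case True
  then obtain b where "b \<in> B"
    by (auto simp: hyperspace_def)
  then show ?thesis
    using True infdist_le_hausdorff_dist[of B C b] infdist_nonneg[of b C] by linarith
qed (auto simp: hausdorff_dist_def)

lemma infdist_triangle_hausdorff_dist:
  assumes "B \<in> hyperspace" "C \<in> hyperspace" "D \<in> hyperspace" "b \<in> B"
  shows "infdist b D \<le> hausdorff_dist B C + hausdorff_dist C D"
proof -
  have C: "compact C" "C \<noteq> {}"
    using assms by (auto simp: hyperspace_def)
  have "continuous_on C (\<lambda>y. dist b y)"
    by (intro continuous_intros)
  then obtain c where c: "c \<in> C" and min: "\<And>y. y \<in> C \<Longrightarrow> dist b c \<le> dist b y"
    using continuous_attains_inf[OF C] by blast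
  have "dist b c \<le> infdist b C"
    using C min by (simp add: infdist_notempty cINF_greatest)
  have "infdist b D \<le> infdist c D + dist b c"
    by (rule infdist_triangle)
  also have "\<dots> \<le> hausdorff_dist C D + hausdorff_dist B C"
    using assms c \<open>dist b c \<le> infdist b C\<close>
      infdist_le_hausdorff_dist[of C D c] infdist_le_hausdorff_dist[of B C b] by simp
  finally show ?thesis
    by simp
qed

lemma Metric_space_hyperspace: "Metric_space hyperspace hausdorff_dist"
proof
  fix B C D :: "'a set"
  show "0 \<le> hausdorff_dist B C"
    by (rule hausdorff_dist_nonneg)
  show "hausdorff_dist B C = hausdorff_dist C B"
    by (rule hausdorff_dist_commute)
  assume B: "B \<in> hyperspace" and C: "C \<in> hyperspace"
  have sub: "P \<subseteq> Q" if "hausdorff_dist P Q = 0" "P \<in> hyperspace" "Q \<in> hyperspace"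
    for P Q :: "'a set"
  proof
    fix p assume "p \<in> P"
    with that have "infdist p Q = 0"
      using infdist_le_hausdorff_dist[of P Q p] infdist_nonneg[of p Q] by linarith
    with that show "p \<in> Q"
      by (auto simp: hyperspace_def in_closed_iff_infdist_zero compact_imp_closed)
  qed
  show "hausdorff_dist B C = 0 \<longleftrightarrow> B = C"
  proof
    assume "hausdorff_dist B C = 0"
    then show "B = C"
      using sub[of B C] sub[of C B] B C by (simp add: hausdorff_dist_commute)
  next
    assume "B = C"
    then show "hausdorff_dist B C = 0"
      using B by (intro antisym hausdorff_dist_nonneg hausdorff_dist_le) auto
  qed
  assume D: "D \<in> hyperspace"
  show "hausdorff_dist B D \<le> hausdorff_dist B C + hausdorff_dist C D"
  proof (rule hausdorff_dist_le[OF B D])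
    show "infdist b D \<le> hausdorff_dist B C + hausdorff_dist C D" if "b \<in> B" for b
      by (rule infdist_triangle_hausdorff_dist[OF B C D that])
    show "infdist d B \<le> hausdorff_dist B C + hausdorff_dist C D" if "d \<in> D" for d
      using infdist_triangle_hausdorff_dist[OF D C B that]
      by (simp add: hausdorff_dist_commute add.commute)
  qed
qed

lemma topspace_hyperspace_topology [simp]: "topspace hyperspace_topology = hyperspace"
  by (simp add: hyperspace_topology_def Metric_space.topspace_mtopology Metric_space_hyperspace)

lemma summable_shift_dist:
  "summable (\<lambda>i. (if \<alpha> i = \<beta> i then 0 else 1) / 2 ^ i :: real)"
proof (rule summable_comparison_test')
  show "summable (\<lambda>i. (1 / 2) ^ i :: real)"
    by (simp add: summable_geometric)
  show "norm ((if \<alpha> n = \<beta> n then 0 else 1) / 2 ^ n :: real) \<le> (1 / 2) ^ n" for n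
    by (simp add: power_one_over)
qed

lemma Metric_space_shift_space: "Metric_space (shift_space N A) shift_dist"
proof
  fix \<alpha> \<beta> \<gamma> :: "nat \<Rightarrow> nat"
  show "0 \<le> shift_dist \<alpha> \<beta>"
    unfolding shift_dist_def by (intro suminf_nonneg summable_shift_dist) auto
  show "shift_dist \<alpha> \<beta> = shift_dist \<beta> \<alpha>"
    by (simp add: shift_dist_def eq_commute)
  show "shift_dist \<alpha> \<beta> = 0 \<longleftrightarrow> \<alpha> = \<beta>"
    unfolding shift_dist_def
    by (subst suminf_eq_zero_iff[OF summable_shift_dist]) (auto simp: fun_eq_iff)
  show "shift_dist \<alpha> \<gamma> \<le> shift_dist \<alpha> \<beta> + shift_dist \<beta> \<gamma>"
    unfolding shift_dist_def suminf_add[OF summable_shift_dist summable_shift_dist]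
    by (intro suminf_le summable_add summable_shift_dist) (auto simp: divide_simps)
qed

lemma topspace_shift_topology [simp]: "topspace (shift_topology N A) = shift_space N A"
  by (simp add: shift_topology_def Metric_space.topspace_mtopology Metric_space_shift_space)

end

theory Submission
  imports Defs
begin

text \<open>
  Every \<open>C n\<close> can be taken to consist of singletons: the map sending \<open>x\<close> to \<open>{x}\<close> is an
  isometric embedding, so it suffices to semiconjugate a point-valued subsystem. Let
  \<open>\<Lambda> n\<close> be the set of points whose orbit from time \<open>n\<close> on follows some admissible itinerary
  through the sets \<open>V i\<close>. Admissibility only constrains two consecutive steps, so \<open>\<Lambda> n\<close> is an
  intersection of finite unions of closed sets. As the finitely many closed sets \<open>V i n\<close> are
  disjoint, the itinerary is unique and each of its entries is locally constant; and every
  admissible sequence is realised, by compactness.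
\<close>

section \<open>Singletons in the hyperspace, and the shift space\<close>

lemma hausdorff_dist_singleton: "hausdorff_dist {x} {y} = dist x y"
  by (simp add: hausdorff_dist_def hyperspace_def dist_commute)

text \<open>Transfers compactness from a set of points to its family of singletons.\<close>

lemma continuous_map_singleton: "continuous_map euclidean hyperspace_topology (\<lambda>x. {x})"
proof -
  have "continuous_map (Met_TC.mtopology) hyperspace_topology (\<lambda>x::'a. {x})"
    unfolding hyperspace_topology_def
      Met_TC.metric_continuous_map[OF Metric_space_hyperspace]
    by (auto simp: hausdorff_dist_singleton) (auto simp: hyperspace_def)
  then show ?thesis
    by simp
qed

text \<open>The first \<open>K\<close> terms vanish and the rest is bounded by a geometric tail.
  This turns agreement on a long initial block into closeness.\<close>

lemma shift_dist_le:
  assumes "\<And>i. i < K \<Longrightarrow> \<alpha> i = \<beta> i"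
  shows "shift_dist \<alpha> \<beta> \<le> 2 / 2 ^ K"
proof -
  let ?t = "\<lambda>i. (if \<alpha> i = \<beta> i then 0 else 1) / 2 ^ i :: real"
  have geom: "(\<lambda>i. 1 / 2 ^ (i + K) :: real) sums (2 / 2 ^ K)"
    using sums_mult[OF geometric_sums[of "1 / 2 :: real"], of "1 / 2 ^ K"]
    by (simp add: power_add power_one_over mult.commute)
  have "shift_dist \<alpha> \<beta> = (\<Sum>i. ?t (i + K))"
    unfolding shift_dist_def suminf_split_initial_segment[OF summable_shift_dist, of _ _ K]
    using assms by simp
  also have "\<dots> \<le> (\<Sum>i. 1 / 2 ^ (i + K))"
  proof (rule suminf_le)
    show "?t (i + K) \<le> 1 / 2 ^ (i + K)" for i
      by simp
    show "summable (\<lambda>i. ?t (i + K))"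
      by (rule summable_ignore_initial_segment[OF summable_shift_dist])
    show "summable (\<lambda>i. 1 / 2 ^ (i + K) :: real)"
      using geom by (rule sums_summable)
  qed
  finally show ?thesis
    using geom by (simp add: sums_iff)
qed

text \<open>Every row of \<open>A\<close> contains a 1, so a successor can be chosen for each
  symbol; iterating that choice from the symbol 1 gives an admissible sequence.\<close>

lemma shift_space_nonempty:
  assumes "transition_matrix N A"
  shows "shift_space N A \<noteq> {}"
proof -
  define g where "g i = (SOME j. j \<in> {1..N} \<and> A i j = 1)" for i
  have g: "g i \<in> {1..N} \<and> A i (g i) = 1" if i: "i \<in> {1..N}" for i
  proof -
    have "(\<Sum>j=1..N. A i j) \<noteq> 0"
      using assms i by (force simp: transition_matrix_def)
    then obtain j where "j \<in> {1..N}" "A i j \<noteq> 0"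
      by (meson sum.neutral)
    then have "j \<in> {1..N} \<and> A i j = 1"
      using assms i by (force simp: transition_matrix_def)
    then show ?thesis
      unfolding g_def by (rule someI)
  qed
  have range: "(g ^^ k) 1 \<in> {1..N}" for k
  proof (induction k)
    case 0
    then show ?case
      using assms by (simp add: transition_matrix_def)
  next
    case (Suc k)
    then show ?case
      using g by simp
  qed
  have "(\<lambda>k. (g ^^ k) 1) \<in> shift_space N A"
    unfolding shift_space_def using range g by auto
  then show ?thesis
    by blast
qed

section \<open>Iterates of the nonautonomous system and their itineraries\<close>

lemma f_iter_Suc_shift: "f_iter f n (Suc k) x = f_iter f (Suc n) k (f n x)"
  by (induction k) auto

lemma continuous_on_f_iter:
  assumes "\<And>n. continuous_on UNIV (f n)"
  shows "continuous_on UNIV (f_iter f n k)"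
proof (induction k)
  case (Suc k)
  then show ?case
    unfolding f_iter.simps
    by (rule continuous_on_compose) (rule continuous_on_subset[OF assms], simp)
qed (simp add: id_def)

text \<open>The description is meaningful only where exactly one \<open>V i (n + k)\<close> contains
  the iterate: disjointness gives uniqueness, and admissibility of \<open>x\<close> gives
  existence.\<close>

definition itinerary_of ::
    "(nat \<Rightarrow> 'a \<Rightarrow> 'a) \<Rightarrow> nat \<Rightarrow> (nat \<Rightarrow> nat \<Rightarrow> 'a set) \<Rightarrow> nat \<Rightarrow> 'a \<Rightarrow> nat \<Rightarrow> nat" where
  "itinerary_of f N V n x k = (THE i. i \<in> {1..N} \<and> f_iter f n k x \<in> V i (n + k))"

definition admissible_points ::
    "(nat \<Rightarrow> 'a \<Rightarrow> 'a) \<Rightarrow> nat \<Rightarrow> (nat \<Rightarrow> nat \<Rightarrow> nat) \<Rightarrow> (nat \<Rightarrow> nat \<Rightarrow> 'a set) \<Rightarrow> nat \<Rightarrow> 'a set" where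
  "admissible_points f N A V n =
     {x. \<exists>\<alpha>\<in>shift_space N A. \<forall>k. f_iter f n k x \<in> V (\<alpha> k) (n + k)}"

locale coded_system =
  fixes f :: "nat \<Rightarrow> 'a::metric_space \<Rightarrow> 'a"
    and N :: nat
    and A :: "nat \<Rightarrow> nat \<Rightarrow> nat"
    and V :: "nat \<Rightarrow> nat \<Rightarrow> 'a set"
  assumes compact_space: "compact (UNIV :: 'a set)"
    and continuous: "\<And>n. continuous_on UNIV (f n)"
    and closed_V: "\<And>i n. i \<in> {1..N} \<Longrightarrow> closed (V i n)"
    and disjoint_V:
      "\<And>i j n. i \<in> {1..N} \<Longrightarrow> j \<in> {1..N} \<Longrightarrow> i \<noteq> j \<Longrightarrow> V i n \<inter> V j n = {}"
    and itinerary_set_nonempty: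
      "\<And>\<alpha> m n. \<alpha> \<in> shift_space N A \<Longrightarrow> itinerary_set f V \<alpha> m n \<noteq> {}"
begin

abbreviation \<Lambda> :: "nat \<Rightarrow> 'a set" where
  "\<Lambda> \<equiv> admissible_points f N A V"

abbreviation code :: "nat \<Rightarrow> 'a \<Rightarrow> nat \<Rightarrow> nat" where
  "code \<equiv> itinerary_of f N V"

lemma code_eqI:
  assumes "i \<in> {1..N}" "f_iter f n k x \<in> V i (n + k)"
  shows "code n x k = i"
  unfolding itinerary_of_def using assms disjoint_V by (intro the_equality) blast+

lemma code_eq:
  assumes "\<alpha> \<in> shift_space N A" "\<And>k. f_iter f n k x \<in> V (\<alpha> k) (n + k)"
  shows "code n x = \<alpha>"
proof
  show "code n x k = \<alpha> k" for k
    using assms by (intro code_eqI) (auto simp: shift_space_def)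
qed

lemma code_in_shift_space: "x \<in> \<Lambda> n \<Longrightarrow> code n x \<in> shift_space N A"
  and f_iter_in_V_code: "x \<in> \<Lambda> n \<Longrightarrow> f_iter f n k x \<in> V (code n x k) (n + k)"
  using code_eq by (auto simp: admissible_points_def)

lemma code_range: "x \<in> \<Lambda> n \<Longrightarrow> code n x k \<in> {1..N}"
  using code_in_shift_space by (auto simp: shift_space_def)

lemma closed_vimage_V: "i \<in> {1..N} \<Longrightarrow> closed (f_iter f n k -` V i m)"
  by (intro closed_vimage closed_V continuous_on_f_iter continuous)

text \<open>Replaces the quantifier over whole sequences by one condition for each pair of
  consecutive times. Each condition is a finite union of closed sets, whence closedness of
  \<open>\<Lambda> n\<close>.\<close>

lemma admissible_points_eq:
  "\<Lambda> n = (\<Inter>k. \<Union>(i, j)\<in>{p \<in> {1..N} \<times> {1..N}. A (fst p) (snd p) = 1}.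
     f_iter f n k -` V i (n + k) \<inter> f_iter f n (Suc k) -` V j (n + Suc k))"
  (is "_ = ?R")
proof
  show "\<Lambda> n \<subseteq> ?R"
  proof
    fix x assume "x \<in> \<Lambda> n"
    then obtain \<alpha> where \<alpha>: "\<alpha> \<in> shift_space N A" "\<And>k. f_iter f n k x \<in> V (\<alpha> k) (n + k)"
      by (auto simp: admissible_points_def)
    show "x \<in> ?R"
    proof
      fix k
      show "x \<in> (\<Union>(i, j)\<in>{p \<in> {1..N} \<times> {1..N}. A (fst p) (snd p) = 1}.
          f_iter f n k -` V i (n + k) \<inter> f_iter f n (Suc k) -` V j (n + Suc k))"
        using \<alpha>(1) \<alpha>(2)[of k] \<alpha>(2)[of "Suc k"]
        by (intro UN_I[of "(\<alpha> k, \<alpha> (Suc k))"]) (simp_all add: shift_space_def)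
    qed
  qed
  show "?R \<subseteq> \<Lambda> n"
  proof
    fix x assume x: "x \<in> ?R"
    \<comment> \<open>The pairs are given separately for each \<open>k\<close>. By disjointness each
      must be \<open>(code n x k, code n x (Suc k))\<close>, so they fit together into one
      sequence.\<close>
    have *: "code n x k \<in> {1..N} \<and> A (code n x k) (code n x (Suc k)) = 1 \<and>
        f_iter f n k x \<in> V (code n x k) (n + k)" for k
    proof -
      obtain i j where ij: "i \<in> {1..N}" "j \<in> {1..N}" "A i j = 1"
          "f_iter f n k x \<in> V i (n + k)" "f_iter f n (Suc k) x \<in> V j (n + Suc k)"
        using x by fastforce
      show ?thesis
        using code_eqI[OF ij(1,4)] code_eqI[OF ij(2,5)] ij by simp
    qed
    then show "x \<in> \<Lambda> n"
      unfolding admissible_points_def shift_space_def by blast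
  qed
qed

lemma compact_admissible_points: "compact (\<Lambda> n)"
proof -
  have "finite {p \<in> {1..N} \<times> {1..N}. A (fst p) (snd p) = 1}"
    by (rule finite_subset[of _ "{1..N} \<times> {1..N}"]) auto
  then have "closed (\<Lambda> n)"
    unfolding admissible_points_eq
    by (intro closed_INT ballI closed_UN) (auto simp del: f_iter.simps intro!: closed_Int closed_vimage_V)
  then show ?thesis
    using compact_Int_closed[OF compact_space] by simp
qed

text \<open>The sets \<open>itinerary_set f V \<alpha> m n\<close> are closed, nonempty and
  decreasing in \<open>m\<close>, so by compactness they share a point; it follows
  \<open>\<alpha>\<close> forever.\<close>

lemma code_surj:
  assumes \<alpha>: "\<alpha> \<in> shift_space N A"
  shows "\<exists>x\<in>\<Lambda> n. code n x = \<alpha>"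
proof -
  have "UNIV \<inter> (\<Inter>m. itinerary_set f V \<alpha> m n) \<noteq> {}"
  proof (rule compact_imp_fip_image[OF compact_space])
    show "closed (itinerary_set f V \<alpha> m n)" for m
      unfolding itinerary_set_def using \<alpha>
      by (intro closed_INT ballI closed_vimage_V) (auto simp: shift_space_def)
    fix I :: "nat set" assume I: "finite I"
    \<comment> \<open>For empty \<open>I\<close> the value \<open>Max I\<close> is unspecified, but
      the inclusion is then vacuous and the set at that index is still nonempty.\<close>
    have "itinerary_set f V \<alpha> (Max I) n \<subseteq> itinerary_set f V \<alpha> m n" if "m \<in> I" for m
      unfolding itinerary_set_def using Max_ge[OF I that] by (intro INF_superset_mono) auto
    then show "UNIV \<inter> (\<Inter>m\<in>I. itinerary_set f V \<alpha> m n) \<noteq> {}"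
      using itinerary_set_nonempty[OF \<alpha>, of "Max I" n] by blast
  qed
  then obtain x where "\<And>m. x \<in> itinerary_set f V \<alpha> m n"
    by blast
  then have x: "f_iter f n k x \<in> V (\<alpha> k) (n + k)" for k
    unfolding itinerary_set_def by fastforce
  then have "x \<in> \<Lambda> n"
    using \<alpha> unfolding admissible_points_def by blast
  then show ?thesis
    using code_eq[OF \<alpha> x] by blast
qed

text \<open>The orbit of \<open>f n x\<close> from time \<open>Suc n\<close> is the tail of the
  orbit of \<open>x\<close>, so it follows the shifted code; uniqueness of codes does the rest. This
  yields both invariance and the conjugacy equation.\<close>

lemma code_shift:
  assumes "x \<in> \<Lambda> n"
  shows "f n x \<in> \<Lambda> (Suc n)" "code (Suc n) (f n x) = shift (code n x)"
proof -
  have \<alpha>: "shift (code n x) \<in> shift_space N A"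
    using code_in_shift_space[OF assms] by (simp add: shift_space_def shift_def)
  have V: "f_iter f (Suc n) k (f n x) \<in> V (shift (code n x) k) (Suc n + k)" for k
    using f_iter_in_V_code[OF assms, of "Suc k"]
    by (simp add: f_iter_Suc_shift shift_def del: f_iter.simps)
  show "f n x \<in> \<Lambda> (Suc n)"
    using \<alpha> V unfolding admissible_points_def by blast
  show "code (Suc n) (f n x) = shift (code n x)"
    using \<alpha> V by (rule code_eq)
qed

lemma code_locally_constant:
  assumes x: "x \<in> \<Lambda> n"
  shows "\<exists>\<delta>>0. \<forall>y\<in>\<Lambda> n. dist x y < \<delta> \<longrightarrow> (\<forall>k<K. code n x k = code n y k)"
proof -
  \<comment> \<open>Keeps the first \<open>K\<close> iterates out of every wrong \<open>V j\<close>.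
    Only finitely many closed sets are removed, and an admissible point of \<open>U\<close> is
    forced to share the first \<open>K\<close> symbols of \<open>x\<close>.\<close>
  define U where
    "U = (\<Inter>k<K. - (\<Union>j\<in>{1..N} - {code n x k}. f_iter f n k -` V j (n + k)))"
  have "open U"
    unfolding U_def by (intro open_INT ballI open_Compl closed_UN closed_vimage_V) auto
  moreover have "x \<in> U"
    unfolding U_def using code_eqI[where n = n and x = x] by auto
  ultimately obtain \<delta> where "\<delta> > 0" and \<delta>: "\<And>y. dist y x < \<delta> \<Longrightarrow> y \<in> U"
    by (auto simp: open_dist)
  have "code n x k = code n y k" if "y \<in> \<Lambda> n" "dist x y < \<delta>" "k < K" for y k
  proof (rule ccontr)
    assume "code n x k \<noteq> code n y k"
    then have "code n y k \<in> {1..N} - {code n x k}"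
      using code_range[OF that(1)] by simp
    moreover have "y \<in> U"
      using \<delta> that(2) by (simp add: dist_commute)
    ultimately show False
      using f_iter_in_V_code[OF that(1)] \<open>k < K\<close> unfolding U_def by blast
  qed
  then show ?thesis
    using \<open>\<delta> > 0\<close> by blast
qed

section \<open>The semiconjugacy on the families of singletons\<close>

lemma singletons_in_hyperspace: "(\<lambda>x. {x}) ` \<Lambda> n \<subseteq> hyperspace"
  by (auto simp: hyperspace_def)

lemma continuous_map_code:
  "continuous_map (subtopology hyperspace_topology ((\<lambda>x. {x}) ` \<Lambda> n))
     (shift_topology N A) (code n \<circ> the_elem)"
proof -
  \<comment> \<open>Presents the subspace topology as that of the restricted metric, so that
    continuity becomes an epsilon-delta statement about points of
    \<open>\<Lambda> n\<close>.\<close>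
  interpret Submetric hyperspace hausdorff_dist "(\<lambda>x. {x}) ` \<Lambda> n"
    by (simp add: Submetric_def Submetric_axioms_def Metric_space_hyperspace
        singletons_in_hyperspace)
  have "\<exists>\<delta>>0. \<forall>y\<in>\<Lambda> n. dist x y < \<delta> \<longrightarrow> shift_dist (code n x) (code n y) < \<epsilon>"
    if "x \<in> \<Lambda> n" "\<epsilon> > 0" for x \<epsilon>
  proof -
    obtain K where "(1 / 2) ^ K < \<epsilon> / 2"
      using real_arch_pow_inv[of "\<epsilon> / 2" "1 / 2"] \<open>\<epsilon> > 0\<close> by auto
    then have "2 / 2 ^ K < \<epsilon>"
      by (simp add: power_one_over)
    then show ?thesis
      using code_locally_constant[OF that(1), of K] shift_dist_le[of K]
      by (meson order.strict_trans1)
  qed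
  then show ?thesis
    unfolding hyperspace_topology_def mtopology_submetric[symmetric] shift_topology_def
      sub.metric_continuous_map[OF Metric_space_shift_space]
    using code_in_shift_space by (fastforce simp: hausdorff_dist_singleton)
qed

lemma semiconjugate_singletons:
  "topologically_semiconjugate
     (\<lambda>n. subtopology hyperspace_topology ((\<lambda>x. {x}) ` \<Lambda> n))
     (induced_map f) (shift_topology N A) shift"
  unfolding topologically_semiconjugate_def
proof (intro exI[of _ "\<lambda>n. code n \<circ> the_elem"] allI conjI)
  fix n
  have top: "topspace (subtopology hyperspace_topology ((\<lambda>x. {x}) ` \<Lambda> n)) = (\<lambda>x. {x}) ` \<Lambda> n"
    using singletons_in_hyperspace by auto
  show "continuous_map (subtopology hyperspace_topology ((\<lambda>x. {x}) ` \<Lambda> n))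
      (shift_topology N A) (code n \<circ> the_elem)"
    by (rule continuous_map_code)
  have "code n ` \<Lambda> n = shift_space N A"
    using code_in_shift_space code_surj[where n = n] by (fastforce simp: image_iff)
  then show "(code n \<circ> the_elem) ` topspace (subtopology hyperspace_topology
      ((\<lambda>x. {x}) ` \<Lambda> n)) = topspace (shift_topology N A)"
    unfolding top by (simp add: image_image)
  show "\<forall>x\<in>topspace (subtopology hyperspace_topology ((\<lambda>x. {x}) ` \<Lambda> n)).
      (code (Suc n) \<circ> the_elem) (induced_map f n x) = shift ((code n \<circ> the_elem) x)"
    unfolding top by (auto simp: induced_map_def code_shift)
qed

end

theorem theorem4p1:
  fixes f :: "nat \<Rightarrow> 'a::metric_space \<Rightarrow> 'a"
    and N :: nat
    and A :: "nat \<Rightarrow> nat \<Rightarrow> nat"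
    and V :: "nat \<Rightarrow> nat \<Rightarrow> 'a set"
  assumes "compact (UNIV :: 'a set)"
    and "\<And>n. continuous_on UNIV (f n)"
    and "transition_matrix N A"
    and "\<And>i n. i \<in> {1..N} \<Longrightarrow> closed (V i n) \<and> V i n \<noteq> {}"
    and "\<And>i j n. i \<in> {1..N} \<Longrightarrow> j \<in> {1..N} \<Longrightarrow> i \<noteq> j \<Longrightarrow> V i n \<inter> V j n = {}"
    and "\<And>\<alpha> m n. \<alpha> \<in> shift_space N A \<Longrightarrow> itinerary_set f V \<alpha> m n \<noteq> {}"
  shows "\<exists>C :: nat \<Rightarrow> 'a set set.
    (\<forall>n. C n \<noteq> {} \<and> compactin hyperspace_topology (C n) \<and>
         C n \<subseteq> (\<Union>i\<in>{1..N}. hyperspace_within (V i n)) \<and>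
         induced_map f n ` C n \<subseteq> C (Suc n)) \<and>
    topologically_semiconjugate (\<lambda>n. subtopology hyperspace_topology (C n))
      (induced_map f) (shift_topology N A) shift"
proof -
  interpret coded_system f N A V
    using assms by unfold_locales auto
  let ?C = "\<lambda>n. (\<lambda>x. {x}) ` \<Lambda> n"
  have "?C n \<noteq> {}" for n
    using shift_space_nonempty[OF assms(3)] code_surj by blast
  moreover have "compactin hyperspace_topology (?C n)" for n
    by (rule image_compactin[OF _ continuous_map_singleton])
      (simp add: compact_admissible_points)
  moreover have "?C n \<subseteq> (\<Union>i\<in>{1..N}. hyperspace_within (V i n))" for n
    \<comment> \<open>At position 0 the iterate is the identity, so the first symbol of the code
      names the \<open>V i n\<close> containing the point.\<close>
    using code_range[of _ n 0] f_iter_in_V_code[of _ n 0]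
    by (fastforce simp: hyperspace_within_def hyperspace_def)
  moreover have "induced_map f n ` ?C n \<subseteq> ?C (Suc n)" for n
    by (auto simp: induced_map_def code_shift)
  ultimately show ?thesis
    using semiconjugate_singletons by (intro exI[of _ ?C]) blast
qed

end
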